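(* Let $\alpha$ be an ordinal. Every dimension-complemented substitution algebra of dimension $\alpha$ is embeddable in a dimension-complemented substitution algebra of dimension $\alpha$ in which elements are distinguished.
   Context: A substitution algebra of dimension $\alpha$ ($SA_\alpha$) is an algebra $\langle A,*_\kappa,v_\kappa\rangle_{\kappa<\alpha}$ satisfying, for all $\kappa,\lambda<\alpha$: (1) $x*_\kappa v_\kappa=x$; (2) $x*_\kappa v_\lambda=v_\lambda$ for $\kappa\neq\lambda$; (3) $v_\kappa*_\kappa x=x$; (4) if $w*_\lambda x=x$ for all $w$, then $x*_\lambda(v_\lambda*_\kappa z)=x*_\lambda(x*_\kappa z)$; (5) $(x*_\kappa y)*_\kappa z=x*_\kappa(y*_\kappa z)$; (6) if $w*_\lambda x=x$ for all $w$, then $x*_\kappa(y*_\lambda z)=(x*_\kappa y)*_\lambda(x*_\kappa z)$ for $\kappa\neq\lambda$. For $x\in A$, $\Delta x=\{\kappa<\alpha: a*_\kappa x\neq x\text{ for some }a\in A\}$. An $SA_\alpha$ is dimension-complemented if for every finite $X\subseteq A$ the set $\alpha-\bigcup\{\Delta x:x\in X\}$ is infinite. Elements are distinguished in an $SA_\alpha$ if for all $\kappa<\alpha$ and all $x\neq y$ in $A$ there is $c\in A$ with $\Delta c=\emptyset$ and $c*_\kappa x\neq c*_\kappa y$. *)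

theory Defs
  imports Main
begin

text \<open>
  An ordinal is given by a (reflexive) well-order \<open>\<alpha>\<close>, and \<open>\<kappa> < \<alpha>\<close> is rendered as
  \<open>\<kappa> \<in> Field \<alpha>\<close>. An algebra is given by a carrier \<open>A\<close>, the operations \<open>x \<star>\<^bsub>\<kappa>\<^esub> y\<close> (read:
  \<open>x\<close> is substituted for \<open>v \<kappa>\<close> in \<open>y\<close>) and the distinguished elements \<open>v \<kappa>\<close>; the values of the
  operations outside \<open>A\<close> and \<open>Field \<alpha>\<close> are irrelevant.
\<close>

locale substitution_algebra =
  fixes \<alpha> :: "'i rel"
    and A :: "'a set"
    and sub :: "'a \<Rightarrow> 'i \<Rightarrow> 'a \<Rightarrow> 'a"  ("(_ \<star>\<^bsub>_\<^esub> _)" [71, 0, 71] 70)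
    and v :: "'i \<Rightarrow> 'a"
  assumes sub_closed: "\<lbrakk>\<kappa> \<in> Field \<alpha>; x \<in> A; y \<in> A\<rbrakk> \<Longrightarrow> x \<star>\<^bsub>\<kappa>\<^esub> y \<in> A"
    and var_closed: "\<kappa> \<in> Field \<alpha> \<Longrightarrow> v \<kappa> \<in> A"
    and ax1: "\<lbrakk>\<kappa> \<in> Field \<alpha>; x \<in> A\<rbrakk> \<Longrightarrow> x \<star>\<^bsub>\<kappa>\<^esub> v \<kappa> = x"
    and ax2: "\<lbrakk>\<kappa> \<in> Field \<alpha>; \<mu> \<in> Field \<alpha>; \<kappa> \<noteq> \<mu>; x \<in> A\<rbrakk> \<Longrightarrow> x \<star>\<^bsub>\<kappa>\<^esub> v \<mu> = v \<mu>"
    and ax3: "\<lbrakk>\<kappa> \<in> Field \<alpha>; x \<in> A\<rbrakk> \<Longrightarrow> v \<kappa> \<star>\<^bsub>\<kappa>\<^esub> x = x"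
    and ax4: "\<lbrakk>\<kappa> \<in> Field \<alpha>; \<mu> \<in> Field \<alpha>; x \<in> A; z \<in> A; \<forall>w\<in>A. w \<star>\<^bsub>\<mu>\<^esub> x = x\<rbrakk>
           \<Longrightarrow> x \<star>\<^bsub>\<mu>\<^esub> (v \<mu> \<star>\<^bsub>\<kappa>\<^esub> z) = x \<star>\<^bsub>\<mu>\<^esub> (x \<star>\<^bsub>\<kappa>\<^esub> z)"
    and ax5: "\<lbrakk>\<kappa> \<in> Field \<alpha>; x \<in> A; y \<in> A; z \<in> A\<rbrakk>
           \<Longrightarrow> (x \<star>\<^bsub>\<kappa>\<^esub> y) \<star>\<^bsub>\<kappa>\<^esub> z = x \<star>\<^bsub>\<kappa>\<^esub> (y \<star>\<^bsub>\<kappa>\<^esub> z)"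
    and ax6: "\<lbrakk>\<kappa> \<in> Field \<alpha>; \<mu> \<in> Field \<alpha>; \<kappa> \<noteq> \<mu>; x \<in> A; y \<in> A; z \<in> A; \<forall>w\<in>A. w \<star>\<^bsub>\<mu>\<^esub> x = x\<rbrakk>
           \<Longrightarrow> x \<star>\<^bsub>\<kappa>\<^esub> (y \<star>\<^bsub>\<mu>\<^esub> z) = (x \<star>\<^bsub>\<kappa>\<^esub> y) \<star>\<^bsub>\<mu>\<^esub> (x \<star>\<^bsub>\<kappa>\<^esub> z)"

definition Delta :: "'i rel \<Rightarrow> 'a set \<Rightarrow> ('a \<Rightarrow> 'i \<Rightarrow> 'a \<Rightarrow> 'a) \<Rightarrow> 'a \<Rightarrow> 'i set" where
  "Delta \<alpha> A sub x = {\<kappa> \<in> Field \<alpha>. \<exists>a\<in>A. sub a \<kappa> x \<noteq> x}"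

definition dimension_complemented ::
    "'i rel \<Rightarrow> 'a set \<Rightarrow> ('a \<Rightarrow> 'i \<Rightarrow> 'a \<Rightarrow> 'a) \<Rightarrow> bool" where
  "dimension_complemented \<alpha> A sub \<longleftrightarrow>
     (\<forall>X. finite X \<and> X \<subseteq> A \<longrightarrow> infinite (Field \<alpha> - (\<Union>x\<in>X. Delta \<alpha> A sub x)))"

definition elements_distinguished ::
    "'i rel \<Rightarrow> 'a set \<Rightarrow> ('a \<Rightarrow> 'i \<Rightarrow> 'a \<Rightarrow> 'a) \<Rightarrow> bool" where
  "elements_distinguished \<alpha> A sub \<longleftrightarrow>
     (\<forall>\<kappa>\<in>Field \<alpha>. \<forall>x\<in>A. \<forall>y\<in>A. x \<noteq> y \<longrightarrow>
        (\<exists>c\<in>A. Delta \<alpha> A sub c = {} \<and> sub c \<kappa> x \<noteq> sub c \<kappa> y))"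

definition sa_embedding ::
    "'i rel \<Rightarrow> 'a set \<Rightarrow> ('a \<Rightarrow> 'i \<Rightarrow> 'a \<Rightarrow> 'a) \<Rightarrow> ('i \<Rightarrow> 'a) \<Rightarrow>
     'b set \<Rightarrow> ('b \<Rightarrow> 'i \<Rightarrow> 'b \<Rightarrow> 'b) \<Rightarrow> ('i \<Rightarrow> 'b) \<Rightarrow> ('a \<Rightarrow> 'b) \<Rightarrow> bool" where
  "sa_embedding \<alpha> A subA vA B subB vB f \<longleftrightarrow>
     f ` A \<subseteq> B \<and> inj_on f A \<and>
     (\<forall>\<kappa>\<in>Field \<alpha>. f (vA \<kappa>) = vB \<kappa>) \<and>
     (\<forall>\<kappa>\<in>Field \<alpha>. \<forall>x\<in>A. \<forall>y\<in>A. f (subA x \<kappa> y) = subB (f x) \<kappa> (f y))"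

text \<open>
  HOL cannot quantify existentially over types, so a statement asserting the existence of an
  algebra has to name a type that contains its carrier. The following type has room for a reduced
  power of \<open>A\<close> over the sequences of indices (one representative function for each class); new
  constants can be found there as the functions \<open>\<lambda>\<rho>. v (\<rho> n)\<close>.
\<close>

type_synonym ('i, 'a) extension = "(nat \<Rightarrow> 'i) \<Rightarrow> 'a"

end

theory Submission
  imports Defs "HOL.Filter"
begin

text \<open>
  Call a set of indices small if it is contained in a finite set joined with finitely many
  \<open>\<Delta> x\<close>. By dimension-complementedness the sets of injective index sequences avoiding a given
  small set generate a proper filter. In the reduced power of \<open>A\<close> over this filter, the class of
  \<open>\<lambda>\<rho>. v (\<rho> n)\<close> is a constant, because \<open>\<rho> n\<close> eventually differs from any fixed index. Restrict to
  the elements \<open>g\<close> with \<open>\<Delta> (g \<rho>) \<subseteq> D \<union> {\<rho> 0, \<dots>, \<rho> (n - 1)}\<close> eventually, for some small \<open>D\<close> and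
  some \<open>n\<close>: then \<open>g\<close> has dimension set inside \<open>D\<close>, and \<open>\<rho> n\<close> is a fresh variable for \<open>g \<rho>\<close>.
  Substituting a fresh variable loses no information, so these constants distinguish elements.
\<close>

context substitution_algebra
begin

section \<open>Dimension sets and fresh variables\<close>

abbreviation dim :: "'a \<Rightarrow> 'i set" where
  "dim x \<equiv> Delta \<alpha> A sub x"

lemma dim_iff: "\<kappa> \<in> dim x \<longleftrightarrow> \<kappa> \<in> Field \<alpha> \<and> (\<exists>a\<in>A. a \<star>\<^bsub>\<kappa>\<^esub> x \<noteq> x)"
  by (simp add: Delta_def)

lemma dim_var: "\<kappa> \<in> Field \<alpha> \<Longrightarrow> dim (v \<kappa>) \<subseteq> {\<kappa>}"
  using ax2[of _ \<kappa>] by (fastforce simp: dim_iff)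

lemma not_in_dim_if_var_sub:
  assumes "\<kappa> \<in> Field \<alpha>" "\<mu> \<in> Field \<alpha>" "\<kappa> \<noteq> \<mu>" "x \<in> A" "v \<mu> \<star>\<^bsub>\<kappa>\<^esub> x = x"
  shows "\<kappa> \<notin> dim x"
proof -
  have "w \<star>\<^bsub>\<kappa>\<^esub> x = x" if "w \<in> A" for w
    using ax5[of \<kappa> w "v \<mu>" x] ax2[of \<kappa> \<mu> w] assms var_closed that by simp
  then show ?thesis by (auto simp: dim_iff)
qed

text \<open>If neither argument depends on \<open>\<mu>\<close>, axiom 5 settles
  \<open>\<mu> = \<kappa>\<close>. Otherwise axiom 6 carries a test variable \<open>v l\<close>
  through the substitution to \<open>y\<close>, which absorbs it.\<close>

lemma dim_sub:
  assumes inf: "infinite (Field \<alpha>)" and \<kappa>: "\<kappa> \<in> Field \<alpha>" and xy: "x \<in> A" "y \<in> A"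
  shows "dim (x \<star>\<^bsub>\<kappa>\<^esub> y) \<subseteq> dim x \<union> dim y"
proof
  fix \<mu> assume \<mu>: "\<mu> \<in> dim (x \<star>\<^bsub>\<kappa>\<^esub> y)"
  then have \<mu>F: "\<mu> \<in> Field \<alpha>" by (simp add: dim_iff)
  show "\<mu> \<in> dim x \<union> dim y"
  proof (rule ccontr)
    assume "\<mu> \<notin> dim x \<union> dim y"
    then have x: "\<forall>w\<in>A. w \<star>\<^bsub>\<mu>\<^esub> x = x" and y: "\<forall>w\<in>A. w \<star>\<^bsub>\<mu>\<^esub> y = y"
      using \<mu>F by (auto simp: dim_iff)
    show False
    proof (cases "\<mu> = \<kappa>")
      case True
      then have "\<forall>w\<in>A. w \<star>\<^bsub>\<mu>\<^esub> (x \<star>\<^bsub>\<kappa>\<^esub> y) = x \<star>\<^bsub>\<kappa>\<^esub> y"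
        using ax5[of \<kappa> _ x y] x \<kappa> xy by metis
      then show False using \<mu> by (auto simp: dim_iff)
    next
      case False
      \<comment> \<open>\<open>l\<close> differs from \<open>\<kappa>\<close> so that substitution
        at \<open>\<kappa>\<close> fixes \<open>v l\<close>, and from \<open>\<mu>\<close> so that
        \<open>v l\<close> can test dependence on \<open>\<mu>\<close>.\<close>
      obtain l where l: "l \<in> Field \<alpha>" "l \<noteq> \<kappa>" "l \<noteq> \<mu>"
        using infinite_imp_nonempty[of "Field \<alpha> - {\<kappa>, \<mu>}"] inf by auto
      have "v l \<star>\<^bsub>\<mu>\<^esub> (x \<star>\<^bsub>\<kappa>\<^esub> y) = x \<star>\<^bsub>\<kappa>\<^esub> (v l \<star>\<^bsub>\<mu>\<^esub> y)"
        using ax6[of \<kappa> \<mu> x "v l" y] ax2[of \<kappa> l x] False \<kappa> \<mu>F xy x l var_closed by simp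
      also have "\<dots> = x \<star>\<^bsub>\<kappa>\<^esub> y"
        using y l var_closed by simp
      finally show False
        using not_in_dim_if_var_sub[of \<mu> l "x \<star>\<^bsub>\<kappa>\<^esub> y"] \<mu> \<mu>F l xy \<kappa> sub_closed by auto
    qed
  qed
qed

text \<open>The renaming is undone by substituting \<open>v \<kappa>\<close> at
  \<open>\<mu>\<close>: axiom 4 replaces the inner \<open>v \<mu>\<close> by
  \<open>v \<kappa>\<close>, axiom 3 removes that substitution, and the outer one is vacuous because
  \<open>\<mu>\<close> is fresh.\<close>

lemma fresh_var_sub_inj:
  assumes "\<kappa> \<in> Field \<alpha>" "\<mu> \<in> Field \<alpha>" "\<kappa> \<noteq> \<mu>" "x \<in> A" "y \<in> A" "\<mu> \<notin> dim x" "\<mu> \<notin> dim y"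
    and eq: "v \<mu> \<star>\<^bsub>\<kappa>\<^esub> x = v \<mu> \<star>\<^bsub>\<kappa>\<^esub> y"
  shows "x = y"
proof -
  have "v \<kappa> \<star>\<^bsub>\<mu>\<^esub> (v \<mu> \<star>\<^bsub>\<kappa>\<^esub> z) = z" if "z \<in> A" "\<mu> \<notin> dim z" for z
    using ax4[of \<kappa> \<mu> "v \<kappa>" z] ax2[of \<mu> \<kappa>] ax3[of \<kappa> z] assms that var_closed
    by (auto simp: dim_iff)
  then show ?thesis using assms by metis
qed

section \<open>Small index sets and the filter of fresh sequences\<close>

definition small :: "'i set \<Rightarrow> bool" where
  "small D \<longleftrightarrow> (\<exists>X K. finite X \<and> X \<subseteq> A \<and> finite K \<and> D \<subseteq> K \<union> (\<Union>x\<in>X. dim x))"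

lemma small_finite: "finite K \<Longrightarrow> small K"
  unfolding small_def by (intro exI[of _ "{}"] exI[of _ K]) auto

lemma small_dim: "x \<in> A \<Longrightarrow> small (dim x)"
  unfolding small_def by (intro exI[of _ "{x}"] exI[of _ "{}"]) auto

lemma small_Un:
  assumes "small D" "small E"
  shows "small (D \<union> E)"
proof -
  obtain X K Y L where "finite X \<and> X \<subseteq> A \<and> finite K \<and> D \<subseteq> K \<union> (\<Union>x\<in>X. dim x)"
    "finite Y \<and> Y \<subseteq> A \<and> finite L \<and> E \<subseteq> L \<union> (\<Union>x\<in>Y. dim x)"
    using assms unfolding small_def by metis
  then show ?thesis
    unfolding small_def by (intro exI[of _ "X \<union> Y"] exI[of _ "K \<union> L"]) auto
qed

lemma small_UN: "finite X \<Longrightarrow> (\<And>x. x \<in> X \<Longrightarrow> small (D x)) \<Longrightarrow> small (\<Union>x\<in>X. D x)"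
  by (induction X rule: finite_induct) (auto intro: small_Un small_finite)

definition fresh_seqs :: "'i set \<Rightarrow> (nat \<Rightarrow> 'i) set" where
  "fresh_seqs D = {\<rho>. inj \<rho> \<and> range \<rho> \<subseteq> Field \<alpha> - D}"

definition fresh :: "(nat \<Rightarrow> 'i) filter" where
  "fresh = (INF D\<in>Collect small. principal (fresh_seqs D))"

text \<open>The generating family is directed, since sequences avoiding \<open>D \<union> E\<close>
  avoid both \<open>D\<close> and \<open>E\<close>; hence a single small set always
  suffices.\<close>

lemma eventually_fresh:
  "eventually P fresh \<longleftrightarrow> (\<exists>D. small D \<and> (\<forall>\<rho>\<in>fresh_seqs D. P \<rho>))"
proof -
  have "eventually P fresh \<longleftrightarrow>
      (\<exists>D\<in>Collect small. eventually P (principal (fresh_seqs D)))"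
    unfolding fresh_def
  proof (rule eventually_INF_base)
    show "Collect small \<noteq> {}" using small_finite[of "{}"] by auto
  next
    fix D E assume "D \<in> Collect small" "E \<in> Collect small"
    then show "\<exists>C\<in>Collect small. principal (fresh_seqs C)
        \<le> inf (principal (fresh_seqs D)) (principal (fresh_seqs E))"
      by (intro bexI[of _ "D \<union> E"]) (auto simp: fresh_seqs_def small_Un)
  qed
  then show ?thesis by (auto simp: eventually_principal)
qed

lemma eventually_avoids: "small D \<Longrightarrow> eventually (\<lambda>\<rho>. \<rho> n \<in> Field \<alpha> - D) fresh"
  unfolding eventually_fresh fresh_seqs_def by blast

lemma eventually_neq: "eventually (\<lambda>\<rho>. \<rho> n \<noteq> \<kappa>) fresh"
  using eventually_avoids[OF small_finite[of "{\<kappa>}"], of n] by (auto elim: eventually_mono)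

lemma eventually_inj: "eventually (\<lambda>\<rho>. inj \<rho>) fresh"
  unfolding eventually_fresh fresh_seqs_def using small_finite[of "{}"] by blast

section \<open>The reduced power and its finitely supported part\<close>

text \<open>A class is encoded by a chosen member. The choice depends only on the predicate of being
  eventually equal to \<open>g\<close>, so equivalent functions receive the same
  representative.\<close>

definition rep :: "((nat \<Rightarrow> 'i) \<Rightarrow> 'a) \<Rightarrow> (nat \<Rightarrow> 'i) \<Rightarrow> 'a" where
  "rep g = (SOME h. eventually (\<lambda>\<rho>. h \<rho> = g \<rho>) fresh)"

lemma eventually_rep: "eventually (\<lambda>\<rho>. rep g \<rho> = g \<rho>) fresh"
  unfolding rep_def by (rule someI[of _ g]) simp

lemma rep_eq_iff: "rep g = rep h \<longleftrightarrow> eventually (\<lambda>\<rho>. g \<rho> = h \<rho>) fresh"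
proof
  assume "rep g = rep h"
  then show "eventually (\<lambda>\<rho>. g \<rho> = h \<rho>) fresh"
    using eventually_rep[of g] eventually_rep[of h] by (auto elim: eventually_elim2)
next
  assume *: "eventually (\<lambda>\<rho>. g \<rho> = h \<rho>) fresh"
  have "eventually (\<lambda>\<rho>. k \<rho> = g \<rho>) fresh \<longleftrightarrow> eventually (\<lambda>\<rho>. k \<rho> = h \<rho>) fresh" for k
    by (rule eventually_subst) (use * in \<open>auto elim: eventually_mono\<close>)
  then show "rep g = rep h" by (simp add: rep_def)
qed

text \<open>\<open>D\<close> and \<open>n\<close> are fixed before \<open>\<rho>\<close>:
  \<open>D\<close> accounts for the dimension sets of old elements, the first \<open>n\<close>
  entries for finitely many new constants.\<close>

definition fin_supp :: "((nat \<Rightarrow> 'i) \<Rightarrow> 'a) set" where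
  "fin_supp = {g. eventually (\<lambda>\<rho>. g \<rho> \<in> A) fresh \<and>
     (\<exists>D n. small D \<and> eventually (\<lambda>\<rho>. dim (g \<rho>) \<subseteq> D \<union> \<rho> ` {..<n}) fresh)}"

definition ext :: "((nat \<Rightarrow> 'i) \<Rightarrow> 'a) set" where
  "ext = rep ` fin_supp"

definition ext_sub where
  "ext_sub x \<kappa> y = rep (\<lambda>\<rho>. x \<rho> \<star>\<^bsub>\<kappa>\<^esub> y \<rho>)"

lemma ext_sub_rep: "ext_sub (rep g) \<kappa> (rep h) = rep (\<lambda>\<rho>. g \<rho> \<star>\<^bsub>\<kappa>\<^esub> h \<rho>)"
  unfolding ext_sub_def rep_eq_iff
  using eventually_rep[of g] eventually_rep[of h] by eventually_elim simp

lemma const_fin_supp: "a \<in> A \<Longrightarrow> (\<lambda>_. a) \<in> fin_supp"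
  unfolding fin_supp_def using small_dim[of a] by (auto intro!: exI[of _ "dim a"])

lemma new_const_fin_supp: "(\<lambda>\<rho>. v (\<rho> n)) \<in> fin_supp"
proof -
  have *: "eventually (\<lambda>\<rho>. \<rho> n \<in> Field \<alpha>) fresh"
    using eventually_avoids[OF small_finite[of "{}"], of n] by simp
  then have "eventually (\<lambda>\<rho>. v (\<rho> n) \<in> A) fresh"
    by eventually_elim (rule var_closed)
  \<comment> \<open>The bound is \<open>Suc n\<close> because the entry \<open>\<rho> n\<close>
    itself must be included.\<close>
  moreover have "eventually (\<lambda>\<rho>. dim (v (\<rho> n)) \<subseteq> {} \<union> \<rho> ` {..<Suc n}) fresh"
    using * by eventually_elim (use dim_var in fastforce)
  ultimately show ?thesis
    unfolding fin_supp_def using small_finite[of "{}"] by blast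
qed

lemma fin_supp_eventually_closed: "g \<in> fin_supp \<Longrightarrow> eventually (\<lambda>\<rho>. g \<rho> \<in> A) fresh"
  by (simp add: fin_supp_def)

lemma fin_supp_supportE:
  assumes "g \<in> fin_supp"
  obtains D n where "small D" "eventually (\<lambda>\<rho>. dim (g \<rho>) \<subseteq> D \<union> \<rho> ` {..<n}) fresh"
  using assms by (auto simp: fin_supp_def)

text \<open>An entry beyond the bound avoids \<open>D\<close> by the choice of the filter and avoids
  the first \<open>n\<close> entries by injectivity. Having all \<open>m\<close> from
  \<open>n\<close> on lets two elements share a fresh entry.\<close>

lemma fin_supp_fresh:
  assumes "g \<in> fin_supp"
  obtains n where "\<And>m. n \<le> m \<Longrightarrow> eventually (\<lambda>\<rho>. \<rho> m \<in> Field \<alpha> - dim (g \<rho>)) fresh"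
proof -
  obtain D n where D: "small D" "eventually (\<lambda>\<rho>. dim (g \<rho>) \<subseteq> D \<union> \<rho> ` {..<n}) fresh"
    using assms by (rule fin_supp_supportE)
  show thesis
  proof (rule that)
    fix m assume "n \<le> m"
    show "eventually (\<lambda>\<rho>. \<rho> m \<in> Field \<alpha> - dim (g \<rho>)) fresh"
      using D(2) eventually_avoids[OF D(1), of m] eventually_inj
    proof eventually_elim
      case (elim \<rho>)
      have "\<rho> m \<notin> \<rho> ` {..<n}" using elim(3) \<open>n \<le> m\<close> by (auto dest: injD)
      then show ?case using elim by blast
    qed
  qed
qed

lemma sub_fin_supp:
  assumes inf: "infinite (Field \<alpha>)" and \<kappa>: "\<kappa> \<in> Field \<alpha>" and g: "g \<in> fin_supp" and h: "h \<in> fin_supp"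
  shows "(\<lambda>\<rho>. g \<rho> \<star>\<^bsub>\<kappa>\<^esub> h \<rho>) \<in> fin_supp"
proof -
  obtain D n where D: "small D" "eventually (\<lambda>\<rho>. dim (g \<rho>) \<subseteq> D \<union> \<rho> ` {..<n}) fresh"
    using g by (rule fin_supp_supportE)
  obtain E m where E: "small E" "eventually (\<lambda>\<rho>. dim (h \<rho>) \<subseteq> E \<union> \<rho> ` {..<m}) fresh"
    using h by (rule fin_supp_supportE)
  have "eventually (\<lambda>\<rho>. g \<rho> \<star>\<^bsub>\<kappa>\<^esub> h \<rho> \<in> A) fresh"
    using g[THEN fin_supp_eventually_closed] h[THEN fin_supp_eventually_closed]
    by eventually_elim (use \<kappa> sub_closed in auto)
  moreover have "eventually (\<lambda>\<rho>. dim (g \<rho> \<star>\<^bsub>\<kappa>\<^esub> h \<rho>) \<subseteq> (D \<union> E) \<union> \<rho> ` {..<max n m}) fresh"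
    using g[THEN fin_supp_eventually_closed] h[THEN fin_supp_eventually_closed] D(2) E(2)
  proof eventually_elim
    case (elim \<rho>)
    have "dim (g \<rho> \<star>\<^bsub>\<kappa>\<^esub> h \<rho>) \<subseteq> dim (g \<rho>) \<union> dim (h \<rho>)"
      using dim_sub[OF inf \<kappa>] elim by blast
    also have "\<dots> \<subseteq> (D \<union> \<rho> ` {..<n}) \<union> (E \<union> \<rho> ` {..<m})"
      using elim by blast
    also have "\<dots> \<subseteq> (D \<union> E) \<union> \<rho> ` {..<max n m}" by auto
    finally show ?case .
  qed
  ultimately show ?thesis
    unfolding fin_supp_def using small_Un[OF D(1) E(1)] by blast
qed

section \<open>The axioms in the extension\<close>

text \<open>
  Axioms 4 and 6 have a universally quantified premise, so they pass to the reduced power only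
  because the new constants witness the dependence of \<open>g\<close> on \<open>\<kappa>\<close>.
\<close>

lemma ext_fixed_iff:
  assumes \<kappa>: "\<kappa> \<in> Field \<alpha>" and g: "g \<in> fin_supp"
  shows "(\<forall>w\<in>ext. ext_sub w \<kappa> (rep g) = rep g) \<longleftrightarrow> eventually (\<lambda>\<rho>. \<kappa> \<notin> dim (g \<rho>)) fresh"
proof
  assume fixed: "\<forall>w\<in>ext. ext_sub w \<kappa> (rep g) = rep g"
  obtain n where n: "eventually (\<lambda>\<rho>. \<rho> n \<in> Field \<alpha> - dim (g \<rho>)) fresh"
    using fin_supp_fresh[OF g] by blast
  have "ext_sub (rep (\<lambda>\<rho>. v (\<rho> n))) \<kappa> (rep g) = rep g"
    using fixed new_const_fin_supp by (auto simp: ext_def)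
  then have "eventually (\<lambda>\<rho>. v (\<rho> n) \<star>\<^bsub>\<kappa>\<^esub> g \<rho> = g \<rho>) fresh"
    by (simp add: ext_sub_rep rep_eq_iff)
  \<comment> \<open>Eventually \<open>\<rho> n\<close> is an index other than
    \<open>\<kappa>\<close>, so the test by a single variable applies pointwise.\<close>
  then show "eventually (\<lambda>\<rho>. \<kappa> \<notin> dim (g \<rho>)) fresh"
    using n eventually_neq[of n \<kappa>] fin_supp_eventually_closed[OF g]
    by eventually_elim (use not_in_dim_if_var_sub \<kappa> in auto)
next
  assume *: "eventually (\<lambda>\<rho>. \<kappa> \<notin> dim (g \<rho>)) fresh"
  show "\<forall>w\<in>ext. ext_sub w \<kappa> (rep g) = rep g"
  proof
    fix w assume "w \<in> ext"
    then obtain h where h: "h \<in> fin_supp" "w = rep h" by (auto simp: ext_def)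
    have "eventually (\<lambda>\<rho>. h \<rho> \<star>\<^bsub>\<kappa>\<^esub> g \<rho> = g \<rho>) fresh"
      using * h(1)[THEN fin_supp_eventually_closed]
      by eventually_elim (use \<kappa> in \<open>auto simp: dim_iff\<close>)
    then show "ext_sub w \<kappa> (rep g) = rep g" by (simp add: h ext_sub_rep rep_eq_iff)
  qed
qed

text \<open>The negation stays outside \<open>eventually\<close>, since \<open>fresh\<close> is not
  assumed to be an ultrafilter.\<close>

lemma dim_ext_iff:
  assumes "g \<in> fin_supp"
  shows "\<kappa> \<in> Delta \<alpha> ext ext_sub (rep g) \<longleftrightarrow>
    \<kappa> \<in> Field \<alpha> \<and> \<not> eventually (\<lambda>\<rho>. \<kappa> \<notin> dim (g \<rho>)) fresh"
  using ext_fixed_iff[OF _ assms, of \<kappa>] by (auto simp: Delta_def)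

text \<open>The equations hold pointwise. For axioms 4 and 6, \<open>ext_fixed_iff\<close> first
  turns the premise into eventual independence of \<open>g \<rho>\<close> from \<open>\<mu>\<close>.
  Infinitely many indices are required by \<open>dim_sub\<close> for closure.\<close>

lemma substitution_algebra_ext:
  assumes inf: "infinite (Field \<alpha>)"
  shows "substitution_algebra \<alpha> ext ext_sub (\<lambda>\<kappa>. rep (\<lambda>_. v \<kappa>))"
proof
  note ev = fin_supp_eventually_closed
  show "ext_sub x \<kappa> y \<in> ext" if "\<kappa> \<in> Field \<alpha>" "x \<in> ext" "y \<in> ext" for \<kappa> x y
    using that sub_fin_supp[OF inf] by (auto simp: ext_def ext_sub_rep)
  show "rep (\<lambda>_. v \<kappa>) \<in> ext" if "\<kappa> \<in> Field \<alpha>" for \<kappa>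
    using that const_fin_supp var_closed by (auto simp: ext_def)
  show "ext_sub x \<kappa> (rep (\<lambda>_. v \<kappa>)) = x" if \<kappa>: "\<kappa> \<in> Field \<alpha>" and "x \<in> ext" for \<kappa> x
  proof -
    obtain g where g: "g \<in> fin_supp" "x = rep g" using \<open>x \<in> ext\<close> by (auto simp: ext_def)
    show ?thesis unfolding g(2) ext_sub_rep rep_eq_iff
      using ev[OF g(1)] by eventually_elim (use \<kappa> ax1 in auto)
  qed
  show "ext_sub x \<kappa> (rep (\<lambda>_. v \<mu>)) = rep (\<lambda>_. v \<mu>)"
    if \<kappa>: "\<kappa> \<in> Field \<alpha>" "\<mu> \<in> Field \<alpha>" "\<kappa> \<noteq> \<mu>" and "x \<in> ext" for \<kappa> \<mu> x
  proof -
    obtain g where g: "g \<in> fin_supp" "x = rep g" using \<open>x \<in> ext\<close> by (auto simp: ext_def)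
    show ?thesis unfolding g(2) ext_sub_rep rep_eq_iff
      using ev[OF g(1)] by eventually_elim (use \<kappa> ax2 in auto)
  qed
  show "ext_sub (rep (\<lambda>_. v \<kappa>)) \<kappa> x = x" if \<kappa>: "\<kappa> \<in> Field \<alpha>" and "x \<in> ext" for \<kappa> x
  proof -
    obtain g where g: "g \<in> fin_supp" "x = rep g" using \<open>x \<in> ext\<close> by (auto simp: ext_def)
    show ?thesis unfolding g(2) ext_sub_rep rep_eq_iff
      using ev[OF g(1)] by eventually_elim (use \<kappa> ax3 in auto)
  qed
  show "ext_sub x \<mu> (ext_sub (rep (\<lambda>_. v \<mu>)) \<kappa> z) = ext_sub x \<mu> (ext_sub x \<kappa> z)"
    if \<kappa>: "\<kappa> \<in> Field \<alpha>" "\<mu> \<in> Field \<alpha>" and "x \<in> ext" "z \<in> ext"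
      and fixed: "\<forall>w\<in>ext. ext_sub w \<mu> x = x" for \<kappa> \<mu> x z
  proof -
    obtain g h where g: "g \<in> fin_supp" "x = rep g" and h: "h \<in> fin_supp" "z = rep h"
      using \<open>x \<in> ext\<close> \<open>z \<in> ext\<close> by (auto simp: ext_def)
    have "eventually (\<lambda>\<rho>. \<mu> \<notin> dim (g \<rho>)) fresh"
      using fixed ext_fixed_iff[OF \<kappa>(2) g(1)] g(2) by simp
    then show ?thesis unfolding g(2) h(2) ext_sub_rep rep_eq_iff
      using ev[OF g(1)] ev[OF h(1)]
      by eventually_elim (rule ax4, use \<kappa> in \<open>auto simp: dim_iff\<close>)
  qed
  show "ext_sub (ext_sub x \<kappa> y) \<kappa> z = ext_sub x \<kappa> (ext_sub y \<kappa> z)"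
    if \<kappa>: "\<kappa> \<in> Field \<alpha>" and "x \<in> ext" "y \<in> ext" "z \<in> ext" for \<kappa> x y z
  proof -
    obtain g h k where g: "g \<in> fin_supp" "x = rep g" and h: "h \<in> fin_supp" "y = rep h"
      and k: "k \<in> fin_supp" "z = rep k"
      using \<open>x \<in> ext\<close> \<open>y \<in> ext\<close> \<open>z \<in> ext\<close> by (auto simp: ext_def)
    show ?thesis unfolding g(2) h(2) k(2) ext_sub_rep rep_eq_iff
      using ev[OF g(1)] ev[OF h(1)] ev[OF k(1)]
      by eventually_elim (use \<kappa> ax5 in auto)
  qed
  show "ext_sub x \<kappa> (ext_sub y \<mu> z) = ext_sub (ext_sub x \<kappa> y) \<mu> (ext_sub x \<kappa> z)"
    if \<kappa>: "\<kappa> \<in> Field \<alpha>" "\<mu> \<in> Field \<alpha>" "\<kappa> \<noteq> \<mu>" and "x \<in> ext" "y \<in> ext" "z \<in> ext"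
      and fixed: "\<forall>w\<in>ext. ext_sub w \<mu> x = x" for \<kappa> \<mu> x y z
  proof -
    obtain g h k where g: "g \<in> fin_supp" "x = rep g" and h: "h \<in> fin_supp" "y = rep h"
      and k: "k \<in> fin_supp" "z = rep k"
      using \<open>x \<in> ext\<close> \<open>y \<in> ext\<close> \<open>z \<in> ext\<close> by (auto simp: ext_def)
    have "eventually (\<lambda>\<rho>. \<mu> \<notin> dim (g \<rho>)) fresh"
      using fixed ext_fixed_iff[OF \<kappa>(2) g(1)] g(2) by simp
    then show ?thesis unfolding g(2) h(2) k(2) ext_sub_rep rep_eq_iff
      using ev[OF g(1)] ev[OF h(1)] ev[OF k(1)]
      by eventually_elim (rule ax6, use \<kappa> in \<open>auto simp: dim_iff\<close>)
  qed
qed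

section \<open>Distinguishing elements by new constants\<close>

lemma elements_distinguished_ext: "elements_distinguished \<alpha> ext ext_sub"
  unfolding elements_distinguished_def
proof (intro ballI impI)
  fix \<kappa> x y assume \<kappa>: "\<kappa> \<in> Field \<alpha>" and "x \<in> ext" "y \<in> ext" and neq: "x \<noteq> y"
  then obtain g h where g: "g \<in> fin_supp" "x = rep g" and h: "h \<in> fin_supp" "y = rep h"
    by (auto simp: ext_def)
  obtain m where m: "\<And>j. m \<le> j \<Longrightarrow> eventually (\<lambda>\<rho>. \<rho> j \<in> Field \<alpha> - dim (g \<rho>)) fresh"
    using fin_supp_fresh[OF g(1)] by blast
  obtain n where n: "\<And>j. n \<le> j \<Longrightarrow> eventually (\<lambda>\<rho>. \<rho> j \<in> Field \<alpha> - dim (h \<rho>)) fresh"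
    using fin_supp_fresh[OF h(1)] by blast
  \<comment> \<open>Past both thresholds, \<open>\<rho> j\<close> is fresh for
    \<open>g \<rho>\<close> and \<open>h \<rho>\<close> simultaneously.\<close>
  define j where "j = max m n"
  have fresh_j: "eventually (\<lambda>\<rho>. \<rho> j \<in> Field \<alpha> - dim (g \<rho>)) fresh"
    "eventually (\<lambda>\<rho>. \<rho> j \<in> Field \<alpha> - dim (h \<rho>)) fresh"
    using m[of j] n[of j] by (simp_all add: j_def)
  \<comment> \<open>The only possible member of the dimension set is \<open>\<rho> j\<close>, which
    moves with \<open>\<rho>\<close> and eventually leaves any fixed \<open>\<mu>\<close>.\<close>
  have "eventually (\<lambda>\<rho>. \<mu> \<notin> dim (v (\<rho> j))) fresh" for \<mu>
    using fresh_j(1) eventually_neq[of j \<mu>]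
    by eventually_elim (use dim_var in blast)
  then have closed: "Delta \<alpha> ext ext_sub (rep (\<lambda>\<rho>. v (\<rho> j))) = {}"
    using dim_ext_iff[OF new_const_fin_supp] by blast
  have "ext_sub (rep (\<lambda>\<rho>. v (\<rho> j))) \<kappa> x \<noteq> ext_sub (rep (\<lambda>\<rho>. v (\<rho> j))) \<kappa> y"
  proof
    assume "ext_sub (rep (\<lambda>\<rho>. v (\<rho> j))) \<kappa> x = ext_sub (rep (\<lambda>\<rho>. v (\<rho> j))) \<kappa> y"
    then have "eventually (\<lambda>\<rho>. v (\<rho> j) \<star>\<^bsub>\<kappa>\<^esub> g \<rho> = v (\<rho> j) \<star>\<^bsub>\<kappa>\<^esub> h \<rho>) fresh"
      by (simp add: g h ext_sub_rep rep_eq_iff)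
    then have "eventually (\<lambda>\<rho>. g \<rho> = h \<rho>) fresh"
      using fresh_j eventually_neq[of j \<kappa>] g(1)[THEN fin_supp_eventually_closed]
        h(1)[THEN fin_supp_eventually_closed]
      by eventually_elim (use fresh_var_sub_inj \<kappa> in blast)
    then show False using neq by (simp add: g h rep_eq_iff)
  qed
  then show "\<exists>c\<in>ext. Delta \<alpha> ext ext_sub c = {} \<and> ext_sub c \<kappa> x \<noteq> ext_sub c \<kappa> y"
    using closed new_const_fin_supp by (auto simp: ext_def)
qed

section \<open>Dimension-complementedness and the embedding\<close>

text \<open>Only \<open>D\<close> survives from the support bound: each of the finitely many entries
  \<open>\<rho> i\<close> with \<open>i < n\<close> eventually differs from a given index.\<close>

lemma dim_ext_small:
  assumes "x \<in> ext"
  shows "\<exists>D. small D \<and> Delta \<alpha> ext ext_sub x \<subseteq> D"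
proof -
  obtain g where g: "g \<in> fin_supp" "x = rep g" using assms by (auto simp: ext_def)
  obtain D n where D: "small D" "eventually (\<lambda>\<rho>. dim (g \<rho>) \<subseteq> D \<union> \<rho> ` {..<n}) fresh"
    using g(1) by (rule fin_supp_supportE)
  have "eventually (\<lambda>\<rho>. \<kappa> \<notin> dim (g \<rho>)) fresh" if "\<kappa> \<notin> D" for \<kappa>
  proof -
    have "eventually (\<lambda>\<rho>. \<forall>i\<in>{..<n}. \<rho> i \<noteq> \<kappa>) fresh"
      using eventually_neq by (simp add: eventually_ball_finite)
    then show ?thesis using D(2) by eventually_elim (use that in blast)
  qed
  then show ?thesis using D(1) dim_ext_iff[OF g(1)] g(2) by blast
qed

context
  assumes dc: "dimension_complemented \<alpha> A sub"
begin

lemma small_co_infinite: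
  assumes "small D"
  shows "infinite (Field \<alpha> - D)"
proof -
  obtain X K where X: "finite X" "X \<subseteq> A" "finite K" "D \<subseteq> K \<union> (\<Union>x\<in>X. dim x)"
    using assms unfolding small_def by metis
  then have "infinite ((Field \<alpha> - (\<Union>x\<in>X. dim x)) - K)"
    using dc unfolding dimension_complemented_def by (metis Diff_infinite_finite)
  moreover have "(Field \<alpha> - (\<Union>x\<in>X. dim x)) - K \<subseteq> Field \<alpha> - D"
    using X(4) by blast
  ultimately show ?thesis by (rule infinite_super[rotated])
qed

text \<open>The indices outside a small set are infinite in number, so they contain the range of an
  injective sequence and no basic set is empty.\<close>

lemma fresh_neq_bot: "fresh \<noteq> bot"
proof -
  have "fresh_seqs D \<noteq> {}" if "small D" for D
    using infinite_countable_subset[OF small_co_infinite[OF that]] by (auto simp: fresh_seqs_def)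
  then show ?thesis
    unfolding trivial_limit_def eventually_fresh by blast
qed

lemma dimension_complemented_ext: "dimension_complemented \<alpha> ext ext_sub"
  unfolding dimension_complemented_def
proof (intro allI impI)
  fix X assume X: "finite X \<and> X \<subseteq> ext"
  obtain D where D: "\<And>x. x \<in> ext \<Longrightarrow> small (D x)" "\<And>x. x \<in> ext \<Longrightarrow> Delta \<alpha> ext ext_sub x \<subseteq> D x"
    using dim_ext_small by metis
  have "infinite (Field \<alpha> - (\<Union>x\<in>X. D x))"
    using X D(1) by (intro small_co_infinite small_UN) auto
  moreover have "Field \<alpha> - (\<Union>x\<in>X. D x) \<subseteq> Field \<alpha> - (\<Union>x\<in>X. Delta \<alpha> ext ext_sub x)"
    using X D(2) by blast
  ultimately show "infinite (Field \<alpha> - (\<Union>x\<in>X. Delta \<alpha> ext ext_sub x))"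
    by (rule infinite_super[rotated])
qed

text \<open>Constant functions embed \<open>A\<close>. Injectivity uses properness of the filter: an
  equation \<open>a = b\<close> that does not mention \<open>\<rho>\<close> and holds eventually is
  true.\<close>

lemma sa_embedding_ext:
  "sa_embedding \<alpha> A sub v ext ext_sub (\<lambda>\<kappa>. rep (\<lambda>_. v \<kappa>)) (\<lambda>a. rep (\<lambda>_. a))"
  unfolding sa_embedding_def ext_sub_rep
  using const_fin_supp fresh_neq_bot
  by (auto simp: ext_def inj_on_def rep_eq_iff eventually_const)

end

end

theorem theorem4p3:
  fixes \<alpha> :: "'i rel"
    and A :: "'a set"
    and sub :: "'a \<Rightarrow> 'i \<Rightarrow> 'a \<Rightarrow> 'a"
    and v :: "'i \<Rightarrow> 'a"
  assumes "Well_order \<alpha>"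
    and "substitution_algebra \<alpha> A sub v"
    and "dimension_complemented \<alpha> A sub"
  shows "\<exists>(B :: ('i, 'a) extension set) subB vB f.
           substitution_algebra \<alpha> B subB vB \<and>
           dimension_complemented \<alpha> B subB \<and>
           elements_distinguished \<alpha> B subB \<and>
           sa_embedding \<alpha> A sub v B subB vB f"
proof -
  interpret substitution_algebra \<alpha> A sub v by (rule assms(2))
  \<comment> \<open>The empty set is small, so its complement in the field is infinite.\<close>
  have "infinite (Field \<alpha>)"
    using small_co_infinite[OF assms(3) small_finite[of "{}"]] by simp
  then show ?thesis
    using substitution_algebra_ext dimension_complemented_ext[OF assms(3)]
      elements_distinguished_ext sa_embedding_ext[OF assms(3)] by blast
qed

end
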